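(* Let $N,M,d$ be positive integers with $M\in[3:N]$, $d\ge2$ and $N=dM\pm1$. Then there is an $(N,M)$ storage design array $\mathbf P$ whose number of distinct columns is $$\eta_{\mathbf P}=\begin{cases}d+\left\lceil\frac M2\right\rceil+1,&\text{if }N=dM+1,\\ d+\left\lfloor\frac M2\right\rfloor+1,&\text{if }N=dM-1.\end{cases}$$
   Context: $[a:b]=\{a,a+1,\dots,b\}$. For integers $1\le M\le N$, an $(N,M)$ storage design array (SDA) is an $N\times\frac{N}{\gcd(N,M)}$ array with entries in $\{*,\mathrm{NULL}\}$ such that each column has exactly $M$ entries $*$ and each row has exactly $\frac{M}{\gcd(N,M)}$ entries $*$. For an SDA $\mathbf P$, $\eta_{\mathbf P}$ denotes the number of distinct columns of $\mathbf P$. *)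

theory Defs
  imports Complex_Main "Jordan_Normal_Form.Matrix"
begin

datatype sda_entry = Star | NULL

definition is_sda :: "nat \<Rightarrow> nat \<Rightarrow> sda_entry mat \<Rightarrow> bool" where
  "is_sda N M P \<longleftrightarrow>
     1 \<le> M \<and> M \<le> N \<and>
     P \<in> carrier_mat N (N div gcd N M) \<and>
     (\<forall>j < dim_col P. card {i. i < dim_row P \<and> P $$ (i, j) = Star} = M) \<and>
     (\<forall>i < dim_row P. card {j. j < dim_col P \<and> P $$ (i, j) = Star} = M div gcd N M)"

definition num_distinct_cols :: "'a mat \<Rightarrow> nat" where
  "num_distinct_cols P = card (set (cols P))"

end

theory Submission
  imports Defs
begin

text \<open>
  Read an array as a list of blocks, a column being the set of rows in which it has a star. As
  \<open>gcd N M = 1\<close>, a design consists of \<open>N\<close> blocks of size \<open>M\<close> covering each of \<open>N\<close> points \<open>M\<close> times.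
  Adding \<open>M\<close> fresh points and \<open>M\<close> copies of the block formed by them turns \<open>d\<close> into \<open>d + 1\<close> and
  contributes one distinct block, so \<open>d = 2\<close> suffices. Complementing all blocks exchanges
  \<open>(2 * M + 1, M)\<close> and \<open>(2 * M + 1, M + 1)\<close>, so only \<open>N = 2 * M + 1\<close> is left.

  There, split the points into two \<open>M\<close>-sets and one extra point. Use the first \<open>M\<close>-set \<open>M - 1\<close> times,
  the second one twice, and \<open>M\<close> further blocks through the extra point. All but two or three of the
  latter come in equal pairs, each pair omitting a single point of the second \<open>M\<close>-set.
\<close>

definition block_design :: "nat \<Rightarrow> nat \<Rightarrow> nat set list \<Rightarrow> bool" where
  "block_design N M xs \<longleftrightarrow> length xs = N \<and> (\<forall>S\<in>set xs. S \<subseteq> {..<N} \<and> card S = M) \<and>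
     (\<forall>i<N. length (filter (\<lambda>S. i \<in> S) xs) = M)"

lemma block_design_extend:
  assumes "block_design N M xs" "0 < M"
  shows "block_design (N + M) M (xs @ replicate M {N..<N + M})"
    and "card (set (xs @ replicate M {N..<N + M})) = card (set xs) + 1"
proof -
  have sub: "\<And>S. S \<in> set xs \<Longrightarrow> S \<subseteq> {..<N}" and len: "length xs = N"
    using assms(1) by (auto simp: block_design_def)
  have none: "filter (\<lambda>S. i \<in> S) xs = []" if "\<not> i < N" for i
    using sub that by (auto simp: filter_empty_conv)
  show "block_design (N + M) M (xs @ replicate M {N..<N + M})"
    unfolding block_design_def
  proof (intro conjI ballI allI impI)
    fix i assume "i < N + M"
    then show "length (filter (\<lambda>S. i \<in> S) (xs @ replicate M {N..<N + M})) = M"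
      using assms(1) none[of i] by (cases "i < N") (auto simp: block_design_def)
  next
    fix S assume "S \<in> set (xs @ replicate M {N..<N + M})"
    then have "S \<in> set xs \<or> S = {N..<N + M}" by auto
    then have "S \<subseteq> {..<N + M} \<and> card S = M"
      using assms(1) by (fastforce simp: block_design_def)
    then show "S \<subseteq> {..<N + M}" "card S = M" by auto
  qed (use len in simp)
  \<comment> \<open>The new block is nonempty since \<open>0 < M\<close>, and it misses
    \<open>{..<N}\<close>, which contains every old block.\<close>
  have "{N..<N + M} \<notin> set xs"
    using sub[of "{N..<N + M}"] assms(2) by force
  then show "card (set (xs @ replicate M {N..<N + M})) = card (set xs) + 1"
    using assms(2) by simp
qed

text \<open>A point lies in \<open>M\<close> of the \<open>N\<close> blocks, hence in the
  complements of the other \<open>N - M\<close>. Complementing is its own inverse on subsets of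
  \<open>{..<N}\<close>, so distinct blocks stay distinct.\<close>

lemma block_design_complement:
  assumes "block_design N M xs"
  shows "block_design N (N - M) (map (\<lambda>S. {..<N} - S) xs)"
    and "card (set (map (\<lambda>S. {..<N} - S) xs)) = card (set xs)"
proof -
  have sub: "\<And>S. S \<in> set xs \<Longrightarrow> S \<subseteq> {..<N}" and len: "length xs = N"
    and crd: "\<And>S. S \<in> set xs \<Longrightarrow> card S = M"
    and row: "\<And>i. i < N \<Longrightarrow> length (filter (\<lambda>S. i \<in> S) xs) = M"
    using assms by (auto simp: block_design_def)
  show "block_design N (N - M) (map (\<lambda>S. {..<N} - S) xs)"
    unfolding block_design_def
  proof (intro conjI ballI allI impI)
    fix i assume "i < N"
    then have "length (filter (\<lambda>S. i \<in> S) (map (\<lambda>S. {..<N} - S) xs))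
        = length (filter (\<lambda>S. i \<notin> S) xs)"
      by (simp add: filter_map o_def)
    with sum_length_filter_compl[of "\<lambda>S. i \<in> S" xs] row[OF \<open>i < N\<close>] len
    show "length (filter (\<lambda>S. i \<in> S) (map (\<lambda>S. {..<N} - S) xs)) = N - M" by simp
  next
    fix T assume "T \<in> set (map (\<lambda>S. {..<N} - S) xs)"
    then obtain S where "S \<in> set xs" "T = {..<N} - S" by auto
    then show "card T = N - M"
      using sub[of S] crd[of S] by (simp add: card_Diff_subset finite_subset)
  qed (use len in auto)
  have "inj_on (\<lambda>S. {..<N} - S) (set xs)"
    using sub by (intro inj_on_inverseI[where g = "\<lambda>S. {..<N} - S"]) (auto simp: double_diff)
  then show "card (set (map (\<lambda>S. {..<N} - S) xs)) = card (set xs)"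
    by (simp add: card_image)
qed

text \<open>Used below to count the blocks \<open>D r\<close> with \<open>r < n\<close> through the
  point \<open>M + t\<close>.\<close>

lemma length_filter_neq_upt: "length (filter (\<lambda>r. r \<noteq> t) [0..<n]) = n - of_bool (t < n)"
  by (induction n) auto

text \<open>With \<open>m = M div 2\<close>, the equal pairs supply \<open>2 * (m - 1)\<close> of
  the \<open>M\<close> blocks through \<open>2 * M\<close>; \<open>U\<close>, \<open>V\<close> and,
  for odd \<open>M\<close>, \<open>D (M - 1)\<close> supply the rest. Each pair costs only one
  distinct block.\<close>

lemma block_design_double_plus_one:
  assumes "2 \<le> M"
  shows "\<exists>xs. block_design (2 * M + 1) M xs \<and> card (set xs) = (M + 1) div 2 + 3"
proof -
  define m H where "m = M div 2" and "H = M - m"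
  define A B :: "nat set" where "A = {..<M}" and "B = {M..<2 * M}"
  define D :: "nat \<Rightarrow> nat set" where "D r = {M..2 * M} - {M + r}" for r
  \<comment> \<open>\<open>U\<close> and \<open>V\<close> share out \<open>A\<close>, so each of its
    points gets its \<open>M\<close>-th block. Both contain the first \<open>m - 1\<close> points of
    \<open>B\<close>, which are those omitted by the pairs. The last interval of \<open>V\<close> is
    \<open>{2 * M}\<close> for even \<open>M\<close>; for odd \<open>M\<close> it also contains
    \<open>2 * M - 1\<close>, the point omitted by \<open>D (M - 1)\<close>.\<close>
  define U V where "U = {..<H} \<union> {M..<M + (m - 1)} \<union> {2 * M}"
    and "V = {H..<M + (m - 1)} \<union> {M + 2 * m..2 * M}"
  define W where "W = (if odd M then [D (M - 1)] else [])"
  define xs where "xs = replicate (M - 1) A @ replicate 2 B @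
    map D [0..<m - 1] @ map D [0..<m - 1] @ [U, V] @ W"
  have m: "1 \<le> m" "2 * m \<le> M" "M \<le> 2 * m + 1" "H + m = M" "m \<le> H" "H \<le> m + 1"
    and par: "M = 2 * m + of_bool (odd M)"
    using assms by (auto simp: m_def H_def)
  have D_card: "card (D r) = M" and D_sub: "D r \<subseteq> {..<2 * M + 1}" if "r < M" for r
    using that by (auto simp: D_def)
  have U_card: "card U = M"
  proof -
    have "card U = H + (m - 1) + 1"
      unfolding U_def using m by (subst card_Un_disjoint; auto)+
    then show ?thesis using m by simp
  qed
  have V_card: "card V = M"
  proof -
    have "card V = (M + (m - 1) - H) + (Suc (2 * M) - (M + 2 * m))"
      unfolding V_def using m by (subst card_Un_disjoint) auto
    then show ?thesis using m by simp
  qed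
  have blocks: "S \<subseteq> {..<2 * M + 1} \<and> card S = M" if "S \<in> set xs" for S
  proof -
    have "S \<in> {A, B, U, V} \<union> D ` {..<M}"
      using that m by (auto simp: xs_def W_def split: if_splits)
    then consider "S = A" | "S = B" | r where "r < M" "S = D r" | "S = U" | "S = V" by auto
    then show ?thesis
      using m D_card D_sub U_card V_card
      by cases (auto simp: A_def B_def U_def V_def)
  qed
  have row: "length (filter (\<lambda>S. i \<in> S) xs) = M" if "i < 2 * M + 1" for i
  proof -
    have eq: "length (filter (\<lambda>S. i \<in> S) xs) = (M - 1) * of_bool (i \<in> A) + 2 * of_bool (i \<in> B)
        + 2 * length (filter (\<lambda>r. i \<in> D r) [0..<m - 1])
        + of_bool (i \<in> U) + of_bool (i \<in> V) + of_bool (odd M \<and> i \<in> D (M - 1))"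
      by (simp add: xs_def W_def filter_map o_def)
    consider "i < M" | t where "t < M" "i = M + t" | "i = 2 * M"
    proof -
      have "i < M \<or> (i - M < M \<and> i = M + (i - M)) \<or> i = 2 * M"
        using \<open>i < 2 * M + 1\<close> by linarith
      then show ?thesis using that by blast
    qed
    then show ?thesis
    proof cases
      case 1
      then have "i \<in> A" "i \<notin> B" "\<And>r. i \<notin> D r" "i \<in> U \<longleftrightarrow> i < H" "i \<in> V \<longleftrightarrow> \<not> i < H"
        using m by (auto simp: A_def B_def D_def U_def V_def)
      then show ?thesis using eq assms by simp
    next
      case 2
      then have "i \<notin> A" "i \<in> B" "\<And>r. i \<in> D r \<longleftrightarrow> r \<noteq> t"
        "i \<in> U \<longleftrightarrow> t < m - 1" "i \<in> V \<longleftrightarrow> t < m - 1 \<or> 2 * m \<le> t"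
        using m by (auto simp: A_def B_def D_def U_def V_def)
      \<comment> \<open>For \<open>t < m - 1\<close> the point misses both copies of
        \<open>D t\<close> and is compensated by \<open>U\<close> and \<open>V\<close>.\<close>
      then have "length (filter (\<lambda>S. i \<in> S) xs) = 2 + 2 * (m - 1 - of_bool (t < m - 1))
          + of_bool (t < m - 1) + of_bool (t < m - 1 \<or> 2 * m \<le> t) + of_bool (odd M \<and> M - 1 \<noteq> t)"
        using eq by (simp add: length_filter_neq_upt)
      \<comment> \<open>For odd \<open>M\<close>, \<open>2 * m \<le> t\<close> means
        \<open>t = M - 1\<close>, where \<open>V\<close> stands in for \<open>D (M - 1)\<close>; for
        even \<open>M\<close> it cannot occur.\<close>
      moreover have "of_bool (t < m - 1 \<or> 2 * m \<le> t) + of_bool (odd M \<and> M - 1 \<noteq> t)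
          = of_bool (t < m - 1) + (of_bool (odd M) :: nat)"
        using m par \<open>t < M\<close> by (cases "odd M") (simp_all add: of_bool_def, linarith+)
      moreover have "m - 1 - of_bool (t < m - 1) + of_bool (t < m - 1) = m - 1"
        by auto
      ultimately show ?thesis
        using m par by linarith
    next
      case 3
      then have "i \<notin> A" "i \<notin> B" "i \<in> U" "i \<in> V" and top: "\<And>r. r < M \<Longrightarrow> i \<in> D r"
        using m by (auto simp: A_def B_def D_def U_def V_def)
      moreover have "filter (\<lambda>r. i \<in> D r) [0..<m - 1] = [0..<m - 1]"
        using m by (intro filter_True) (auto intro!: top)
      ultimately have "length (filter (\<lambda>S. i \<in> S) xs) = 2 * (m - 1) + 2 + of_bool (odd M)"
        using eq top[of "M - 1"] assms by simp
      then show ?thesis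
        using m par by linarith
    qed
  qed
  have len: "length xs = 2 * M + 1"
  proof -
    have "length xs = M - 1 + 2 + 2 * (m - 1) + 2 + of_bool (odd M)"
      by (simp add: xs_def W_def)
    then show ?thesis using m par by linarith
  qed
  \<comment> \<open>The indices \<open>r\<close> of the blocks \<open>D r\<close> in use, each pair
    counted once.\<close>
  define R where "R = {..<m - 1} \<union> (if odd M then {M - 1} else {})"
  have "inj_on D {..<M}"
  proof (rule inj_onI)
    fix r t assume "r \<in> {..<M}" "t \<in> {..<M}" "D r = D t"
    moreover have "M + r \<notin> D r" by (simp add: D_def)
    ultimately have "M + r \<notin> D t" by simp
    then show "r = t" using \<open>r \<in> {..<M}\<close> by (simp add: D_def)
  qed
  then have "inj_on D R"
    by (rule inj_on_subset) (use m in \<open>auto simp: R_def\<close>)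
  then have "card (D ` R) = card R" by (rule card_image)
  also have "\<dots> = m - 1 + of_bool (odd M)"
    using m by (simp add: R_def)
  finally have card_DR: "card (D ` R) = m - 1 + of_bool (odd M)" .
  have set_xs: "set xs = insert A (insert B (insert U (insert V (D ` R))))"
    using assms by (auto simp: xs_def W_def R_def)
  \<comment> \<open>Separating points: \<open>2 * M\<close> tells \<open>A\<close> and
    \<open>B\<close> from all other blocks, \<open>0\<close> tells \<open>A\<close> from
    \<open>B\<close> and \<open>U\<close> from each \<open>D r\<close>, and \<open>M - 1\<close>
    tells \<open>V\<close> from \<open>U\<close> and each \<open>D r\<close>.\<close>
  have top: "2 * M \<notin> A" "2 * M \<notin> B" "2 * M \<in> U" "2 * M \<in> V" "\<And>r. r \<in> R \<Longrightarrow> 2 * M \<in> D r"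
    using m by (auto simp: A_def B_def U_def V_def D_def R_def split: if_splits)
  have low: "0 \<in> A" "0 \<notin> B" "0 \<in> U" "M - 1 \<in> V" "M - 1 \<notin> U" "\<And>r. 0 \<notin> D r" "\<And>r. M - 1 \<notin> D r"
    using m by (auto simp: A_def B_def U_def V_def D_def)
  have "A \<notin> insert B (insert U (insert V (D ` R)))" using top low by auto
  moreover have "B \<notin> insert U (insert V (D ` R))" using top by auto
  moreover have "U \<notin> insert V (D ` R)" using low by auto
  moreover have "V \<notin> D ` R" using low by auto
  moreover have "finite (D ` R)" by (simp add: R_def)
  ultimately have "card (set xs) = m - 1 + of_bool (odd M) + 4"
    using card_DR by (simp add: set_xs)
  also have "\<dots> = (M + 1) div 2 + 3"
    using m par by (cases "odd M") linarith+
  finally show ?thesis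
    using blocks row len by (auto simp: block_design_def)
qed

lemma block_design_dilate:
  assumes "block_design N M xs" "0 < M"
  shows "\<exists>ys. block_design (N + k * M) M ys \<and> card (set ys) = card (set xs) + k"
proof (induction k)
  case (Suc k)
  then obtain ys where "block_design (N + k * M) M ys" "card (set ys) = card (set xs) + k" by blast
  with block_design_extend[OF this(1) assms(2)] show ?case
    by (intro exI conjI) (auto simp: algebra_simps)
qed (use assms in auto)

text \<open>Take the incidence matrix. Since \<open>gcd N M = 1\<close>, it has the required square
  shape and both star counts equal \<open>M\<close>. Its columns are the characteristic vectors
  \<open>c S\<close>, which determine \<open>S\<close> inside \<open>{..<N}\<close>.\<close>

lemma block_design_imp_sda:
  assumes "block_design N M xs" "1 \<le> M" "M \<le> N" "coprime N M"
  shows "\<exists>P. is_sda N M P \<and> num_distinct_cols P = card (set xs)"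
proof -
  have len: "length xs = N" and blk: "\<And>j. j < N \<Longrightarrow> xs ! j \<subseteq> {..<N} \<and> card (xs ! j) = M"
    and row: "\<And>i. i < N \<Longrightarrow> length (filter (\<lambda>S. i \<in> S) xs) = M"
    using assms(1) by (auto simp: block_design_def)
  define P where "P = mat N N (\<lambda>(i, j). if i \<in> xs ! j then Star else NULL)"
  define c where "c S = vec N (\<lambda>i. if i \<in> S then Star else NULL)" for S
  have "{i. i < N \<and> P $$ (i, j) = Star} = xs ! j" if "j < N" for j
    using that blk[OF that] by (auto simp: P_def split: if_splits)
  moreover have "card {j. j < N \<and> P $$ (i, j) = Star} = M" if "i < N" for i
  proof -
    have "{j. j < N \<and> P $$ (i, j) = Star} = {j. j < length xs \<and> i \<in> xs ! j}"
      using that by (auto simp: P_def len split: if_splits)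
    then show ?thesis using row[OF that] by (simp add: length_filter_conv_card)
  qed
  moreover have "gcd N M = 1" using assms(4) by simp
  ultimately have "is_sda N M P"
    using assms(2,3) blk by (auto simp: is_sda_def P_def)
  have "set (cols P) = c ` set xs"
  proof -
    have "col P j = c (xs ! j)" if "j < N" for j
      using that by (auto simp: P_def c_def)
    then show ?thesis
      by (force simp: cols_def P_def set_conv_nth[of xs] len image_iff)
  qed
  moreover have "inj_on c (set xs)"
  proof (rule inj_onI)
    fix S T assume "S \<in> set xs" "T \<in> set xs" "c S = c T"
    then have "S \<subseteq> {..<N}" "T \<subseteq> {..<N}" using assms(1) by (auto simp: block_design_def)
    moreover have "i \<in> S \<longleftrightarrow> i \<in> T" if "i < N" for i
      using arg_cong[OF \<open>c S = c T\<close>, of "\<lambda>v. v $ i"] that by (simp add: c_def split: if_splits)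
    ultimately show "S = T" by blast
  qed
  ultimately have "num_distinct_cols P = card (set xs)"
    by (simp add: num_distinct_cols_def card_image)
  with \<open>is_sda N M P\<close> show ?thesis by blast
qed

theorem theorem7:
  fixes N M d :: nat
  assumes "M \<in> {3..N}" and "d \<ge> 2" and "N = d * M + 1 \<or> N = d * M - 1"
  shows "\<exists>P. is_sda N M P \<and>
           (N = d * M + 1 \<longrightarrow> num_distinct_cols P = d + nat \<lceil>real M / 2\<rceil> + 1) \<and>
           (N = d * M - 1 \<longrightarrow> num_distinct_cols P = d + nat \<lfloor>real M / 2\<rfloor> + 1)"
proof -
  have M: "3 \<le> M" "M \<le> N" using assms(1) by auto
  \<comment> \<open>The base designs have \<open>d = 2\<close>, so \<open>k\<close> extensions
    remain; their \<open>3 + k\<close> distinct blocks beyond the half of \<open>M\<close> are the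
    \<open>d + 1\<close> of the claim.\<close>
  obtain k where d: "d = 2 + k" using assms(2) le_Suc_ex by blast
  have ceil: "nat \<lceil>real M / 2\<rceil> = (M + 1) div 2" by linarith
  have floor: "nat \<lfloor>real M / 2\<rfloor> = M div 2" by linarith
  show ?thesis
    using assms(3)
  proof
    assume N: "N = d * M + 1"
    obtain xs where "block_design (2 * M + 1) M xs" "card (set xs) = (M + 1) div 2 + 3"
      using block_design_double_plus_one[of M] M by auto
    moreover have "2 * M + 1 + k * M = N" by (simp add: N d algebra_simps)
    ultimately obtain ys where "block_design N M ys" "card (set ys) = (M + 1) div 2 + 3 + k"
      using block_design_dilate[of "2 * M + 1" M xs k] M by auto
    moreover have "coprime N M"
    proof (rule coprimeI)
      fix c assume "c dvd N" "c dvd M"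
      then have "c dvd N - d * M" by (intro dvd_diff_nat) auto
      then show "is_unit c" by (simp add: N)
    qed
    ultimately obtain P where "is_sda N M P" "num_distinct_cols P = (M + 1) div 2 + 3 + k"
      using block_design_imp_sda[of N M ys] M by auto
    then show ?thesis
      using N ceil d by (intro exI[of _ P]) auto
  next
    assume N: "N = d * M - 1"
    \<comment> \<open>Keeps the truncated subtraction honest: \<open>d * M - N = 1\<close> is needed
      for coprimality.\<close>
    have dM: "2 * M \<le> d * M" using d by simp
    have M1: "2 \<le> M - 1" "M - 1 + 1 = M" using M by auto
    \<comment> \<open>Complementing the \<open>(2 * M - 1, M - 1)\<close> design gives block size
      \<open>M\<close> on \<open>2 * M - 1\<close> points, the case \<open>d = 2\<close>. Starting
      from \<open>M - 1\<close> turns the ceiling into \<open>M div 2\<close>.\<close>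
    obtain xs where xs: "block_design (2 * (M - 1) + 1) (M - 1) xs"
      "card (set xs) = M div 2 + 3"
      using block_design_double_plus_one[OF M1(1)] unfolding M1(2) by blast
    have "2 * (M - 1) + 1 - (M - 1) = M" using M by simp
    with block_design_complement[OF xs(1)] xs(2) M obtain zs
      where "block_design (2 * (M - 1) + 1) M zs" "card (set zs) = M div 2 + 3" by auto
    moreover have "2 * (M - 1) + 1 + k * M = N"
      using M by (simp add: N d algebra_simps)
    ultimately obtain ys where "block_design N M ys" "card (set ys) = M div 2 + 3 + k"
      using block_design_dilate[of "2 * (M - 1) + 1" M zs k] M by auto
    moreover have "coprime N M"
    proof (rule coprimeI)
      fix c assume "c dvd N" "c dvd M"
      then have "c dvd d * M - N" by (intro dvd_diff_nat) auto
      moreover have "d * M - N = 1" using N M dM by simp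
      ultimately show "is_unit c" by simp
    qed
    ultimately obtain P where "is_sda N M P" "num_distinct_cols P = M div 2 + 3 + k"
      using block_design_imp_sda[of N M ys] M by auto
    then show ?thesis
      using N floor d M dM by (intro exI[of _ P]) auto
  qed
qed

end
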